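(* Let $\{h(n) : n\ge 1\}\subset[0,\infty)$ and $p\in[1,\infty)$. Assume that the collection $\{X^n_s : s\in S_n,\ n\ge 1\}$ of $\mathcal X$-valued random elements is $(\nu_n)$-$\mathrm{UI}(p)$ with respect to $\{h(n)\}$. If $$\lim_{n\to\infty} h(n)\,\nu_n(S_n)=0,$$ then $$\lim_{n\to\infty}\mathbb E\left\|\int_{S_n}X^n_s\,\nu_n(\mathrm ds)\right\|^p=0,$$ and in particular, $\int_{S_n}X^n_s\,\nu_n(\mathrm ds)\to 0$ in probability as $n\to\infty$.
   Context: Standing setting: $(\mathcal X,\|\cdot\|)$ is a separable Banach space with Borel $\sigma$-algebra $\mathcal B(\mathcal X)$; $(\Omega,\mathcal F,\mathbb P)$ is a complete probability space; an $\mathcal X$-valued random element is an $\mathcal F/\mathcal B(\mathcal X)$-measurable map $\Omega\to\mathcal X$. $\{(S_n,\mathcal S_n,\nu_n):n\ge1\}$ is a family of finite measure spaces with $\sup_{n\ge1}\nu_n(S_n)=:C_\nu\in(0,\infty)$. Integrals of $\mathcal X$-valued functions are Bochner integrals. Definition ($(\nu_n)$-$\mathrm{UI}(p)$ w.r.t. $\{h(n)\}$), for $p\in(0,\infty)$ and $h(n)\ge0$: a collection $\{X^n_s:s\in S_n,n\ge1\}$ of $\mathcal X$-valued random elements is $(\nu_n)$-$\mathrm{UI}(p)$ w.r.t. $\{h(n)\}$ if (a) the map $(\omega,s)\mapsto X^n_s(\omega)$ is $\mathcal F\otimes\mathcal S_n/\mathcal B(\mathcal X)$-measurable for every $n\ge1$;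 and (b) $\lim_{n\to\infty}\mathbb E\int_{S_n}\|X^n_s\|^p\,\mathbf 1_{\{\|X^n_s\|>h(n)\}}\,\nu_n(\mathrm ds)=0$. Under this condition with $p\ge1$, there is $n_0$ such that for all $n\ge n_0$ the Bochner integral $\int_{S_n}X^n_s\,\nu_n(\mathrm ds)$ exists almost surely; the limits are understood along $n\ge n_0$. *)

theory Defs
  imports "HOL-Probability.Probability"
begin

text \<open>
  Index spaces are sequences of measures \<open>\<nu> n\<close> whose \<open>space\<close> and \<open>sets\<close> are the underlying set and
  \<open>\<sigma>\<close>-algebra; only the indices \<open>n \<ge> 1\<close> matter. The spaces \<open>space (\<nu> n)\<close> are subsets of
  one type, but need not be related to each other.
\<close>

definition finite_measure_family :: "(nat \<Rightarrow> 's measure) \<Rightarrow> bool" where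
  "finite_measure_family \<nu> \<longleftrightarrow>
     (\<forall>n\<ge>1. finite_measure (\<nu> n)) \<and>
     0 < (SUP n\<in>{1..}. emeasure (\<nu> n) (space (\<nu> n))) \<and>
     (SUP n\<in>{1..}. emeasure (\<nu> n) (space (\<nu> n))) < \<infinity>"

text \<open>
  \<open>X n s \<omega>\<close> is the value at \<open>\<omega>\<close> of the random element with index \<open>s \<in> space (\<nu> n)\<close>.
  The expectation and the inner integral are taken in \<open>[0, \<infinity>]\<close>, so the quantity in the last
  clause is defined, and may be infinite for finitely many \<open>n\<close>. The definition is meant for
  \<open>p > 0\<close> and \<open>h \<ge> 0\<close>.
\<close>

definition UI_wrt ::
  "'a measure \<Rightarrow> (nat \<Rightarrow> 's measure) \<Rightarrow> real \<Rightarrow> (nat \<Rightarrow> real) \<Rightarrow>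
   (nat \<Rightarrow> 's \<Rightarrow> 'a \<Rightarrow> 'x::{banach,second_countable_topology}) \<Rightarrow> bool" where
  "UI_wrt M \<nu> p h X \<longleftrightarrow>
     (\<forall>n\<ge>1. \<forall>s\<in>space (\<nu> n). X n s \<in> borel_measurable M) \<and>
     (\<forall>n\<ge>1. (\<lambda>(\<omega>, s). X n s \<omega>) \<in> borel_measurable (M \<Otimes>\<^sub>M \<nu> n)) \<and>
     ((\<lambda>n. \<integral>\<^sup>+\<omega>. (\<integral>\<^sup>+s. ennreal (norm (X n s \<omega>) powr p) * indicator {s. norm (X n s \<omega>) > h n} s \<partial>\<nu> n) \<partial>M)
        \<longlonglongrightarrow> 0)"

text \<open>
  The measurability clause prevents the second clause from holding vacuously, since
  \<open>measure\<close> is \<open>0\<close> on non-measurable sets.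
\<close>

definition tendsto_in_prob ::
  "'a measure \<Rightarrow> (nat \<Rightarrow> 'a \<Rightarrow> 'x::{banach,second_countable_topology}) \<Rightarrow> ('a \<Rightarrow> 'x) \<Rightarrow> bool" where
  "tendsto_in_prob M Y Z \<longleftrightarrow>
     Z \<in> borel_measurable M \<and> (\<forall>\<^sub>F n in sequentially. Y n \<in> borel_measurable M) \<and>
     (\<forall>\<epsilon>>0. (\<lambda>n. measure M {\<omega> \<in> space M. dist (Y n \<omega>) (Z \<omega>) > \<epsilon>}) \<longlonglongrightarrow> 0)"

end

theory Submission
  imports Defs
begin

text \<open>
  Splitting at level \<open>H + \<delta>\<close> gives
  \<open>\<parallel>f\<parallel> \<le> H + \<delta> + \<delta>\<^sup>1\<^sup>-\<^sup>p \<parallel>f\<parallel>\<^sup>p 1\<^bsub>{\<parallel>f\<parallel> > H}\<^esub>\<close> for every \<open>\<delta> > 0\<close>.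
  Integrating over a finite measure of mass \<open>c\<close> and choosing \<open>\<delta> = D\<^bsup>1/p\<^esup>\<close>, where \<open>D\<close> is the
  truncated \<open>p\<close>-th moment of \<open>f\<close> (\<open>\<delta> \<rightarrow> 0\<close> if \<open>D = 0\<close>), bounds the norm of the integral by
  \<open>H c + (c + 1) D\<^bsup>1/p\<^esup>\<close>.
  Taking \<open>p\<close>-th powers and expectations, both terms vanish in the limit.
\<close>

text \<open>Only norms above \<open>H + \<delta>\<close> need work: such a norm exceeds both
  \<open>H\<close> and \<open>\<delta>\<close>, and since \<open>1 - p \<le> 0\<close>, raising it
  to the power \<open>1 - p\<close> gives at most \<open>\<delta> powr (1 - p)\<close>. Multiplying
  by its \<open>p\<close>-th power gives back the norm.\<close>

lemma norm_le_add_truncated_powr: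
  fixes x :: "'x::real_normed_vector"
  assumes "H \<ge> 0" "p \<ge> 1" "\<delta> > 0"
  shows "ennreal (norm x) \<le> ennreal (H + \<delta>)
    + ennreal (\<delta> powr (1 - p)) * (ennreal (norm x powr p) * (if norm x > H then 1 else 0))"
proof (cases "norm x \<le> H + \<delta>")
  case True
  then show ?thesis
    by (intro add_increasing2) (auto intro: ennreal_leI)
next
  case False
  then have x: "norm x > H" "norm x > \<delta>" using assms by auto
  have "norm x powr (1 - p) \<le> \<delta> powr (1 - p)"
    using x assms by (intro powr_mono2') auto
  then have "norm x powr (1 - p) * norm x powr p \<le> \<delta> powr (1 - p) * norm x powr p"
    by (intro mult_right_mono) auto
  moreover have "norm x powr (1 - p) * norm x powr p = norm x"
    using x assms by (simp flip: powr_add)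
  ultimately have "ennreal (norm x) \<le> ennreal (\<delta> powr (1 - p)) * ennreal (norm x powr p)"
    by (simp add: ennreal_leI flip: ennreal_mult)
  with x show ?thesis by (auto intro: add_increasing)
qed

lemma (in finite_measure) nn_integral_norm_le_truncated_moment:
  fixes f :: "'a \<Rightarrow> 'x::{banach,second_countable_topology}"
  assumes [measurable]: "f \<in> borel_measurable M"
    and "H \<ge> 0" "p \<ge> 1" "d \<ge> 0" "\<delta> > 0"
    and D: "(\<integral>\<^sup>+s. ennreal (norm (f s) powr p) * indicator {s. norm (f s) > H} s \<partial>M) = ennreal d"
  shows "(\<integral>\<^sup>+s. norm (f s) \<partial>M) \<le> ennreal ((H + \<delta>) * measure M (space M) + \<delta> powr (1 - p) * d)"
proof -
  \<comment> \<open>The set under the indicator need not lie in \<open>space M\<close>; written as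
    an \<open>if\<close>, the truncation is measurable through its condition.\<close>
  let ?g = "\<lambda>s. ennreal (norm (f s) powr p) * (if norm (f s) > H then 1 else 0)"
  have D': "(\<integral>\<^sup>+s. ?g s \<partial>M) = ennreal d"
    unfolding D[symmetric] by (intro nn_integral_cong) auto
  have "(\<integral>\<^sup>+s. norm (f s) \<partial>M) \<le> (\<integral>\<^sup>+s. ennreal (H + \<delta>) + ennreal (\<delta> powr (1 - p)) * ?g s \<partial>M)"
    using assms by (intro nn_integral_mono norm_le_add_truncated_powr)
  also have "\<dots> = ennreal (H + \<delta>) * emeasure M (space M) + ennreal (\<delta> powr (1 - p)) * ennreal d"
    by (subst nn_integral_add) (auto simp: nn_integral_cmult D')
  also have "\<dots> = ennreal ((H + \<delta>) * measure M (space M) + \<delta> powr (1 - p) * d)"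
    using assms by (simp add: emeasure_eq_measure ennreal_mult)
  finally show ?thesis .
qed

lemma (in finite_measure) norm_integral_le_truncated_moment:
  fixes f :: "'a \<Rightarrow> 'x::{banach,second_countable_topology}"
  assumes [measurable]: "f \<in> borel_measurable M"
    and "H \<ge> 0" "p \<ge> 1" "d \<ge> 0"
    and D: "(\<integral>\<^sup>+s. ennreal (norm (f s) powr p) * indicator {s. norm (f s) > H} s \<partial>M) = ennreal d"
  shows "integrable M f"
    and "norm (\<integral>s. f s \<partial>M) \<le> H * measure M (space M) + (measure M (space M) + 1) * d powr (1 / p)"
proof -
  let ?c = "measure M (space M)"
  note bnd = nn_integral_norm_le_truncated_moment[OF assms(1-4) _ D]
  \<comment> \<open>Any fixed positive \<open>\<delta>\<close> gives a finite bound, which is all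
    that integrability needs.\<close>
  show int: "integrable M f"
    using bnd[of 1] by (intro integrableI_bounded) (auto intro: le_less_trans)
  have le: "norm (\<integral>s. f s \<partial>M) \<le> (H + \<delta>) * ?c + \<delta> powr (1 - p) * d" if "\<delta> > 0" for \<delta>
  proof -
    have "ennreal (norm (\<integral>s. f s \<partial>M)) \<le> ennreal ((H + \<delta>) * ?c + \<delta> powr (1 - p) * d)"
      using integral_norm_bound_ennreal[OF int] bnd[OF that] by (rule order_trans)
    then show ?thesis using that assms by (subst (asm) ennreal_le_iff) auto
  qed
  show "norm (\<integral>s. f s \<partial>M) \<le> H * ?c + (?c + 1) * d powr (1 / p)"
  proof (cases "d = 0")
    case True
    \<comment> \<open>The choice \<open>\<delta> = d powr (1 / p)\<close> would be zero here, so
      \<open>\<delta>\<close> is sent to 0 instead. Dividing by \<open>?c + 1\<close> rather than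
      \<open>?c\<close> covers the null measure.\<close>
    have "norm (\<integral>s. f s \<partial>M) \<le> H * ?c + e" if "e > 0" for e
    proof -
      have c: "?c + 1 > 0" by (simp add: add_nonneg_pos)
      have "norm (\<integral>s. f s \<partial>M) \<le> (H + e / (?c + 1)) * ?c"
        using le[of "e / (?c + 1)"] that c True by simp
      also have "\<dots> = H * ?c + e * (?c / (?c + 1))"
        by (simp add: algebra_simps)
      also have "\<dots> \<le> H * ?c + e * 1"
        using that c by (intro add_left_mono mult_left_mono) auto
      finally show ?thesis by simp
    qed
    then show ?thesis using True by (simp add: field_le_epsilon)
  next
    case False
    then have "d > 0" using assms by simp
    \<comment> \<open>With \<open>\<delta> = d powr (1 / p)\<close> the two error terms balance:
      \<open>\<delta> powr (1 - p) * d\<close> is again \<open>d powr (1 / p)\<close>, so together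
      they give \<open>?c + 1\<close> copies of it.\<close>
    have "(1 - p) / p + 1 = 1 / p" using assms by (simp add: field_simps)
    then have "d powr ((1 - p) / p) * d = d powr (1 / p)"
      using \<open>d > 0\<close> powr_add[of d "(1 - p) / p" 1] by simp
    moreover have "(d powr (1 / p)) powr (1 - p) = d powr ((1 - p) / p)"
      by (simp add: powr_powr)
    ultimately show ?thesis
      using le[of "d powr (1 / p)"] \<open>d > 0\<close> by (simp add: algebra_simps)
  qed
qed

text \<open>A sum is at most twice the larger term. The constant is cruder than the one from
  convexity, but any constant depending only on \<open>p\<close> serves.\<close>

lemma powr_add_le:
  fixes a b p :: real
  assumes "a \<ge> 0" "b \<ge> 0" "p \<ge> 0"
  shows "(a + b) powr p \<le> 2 powr p * (a powr p + b powr p)"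
proof -
  have "(a + b) powr p \<le> (2 * max a b) powr p"
    using assms by (intro powr_mono2) auto
  also have "\<dots> = 2 powr p * max a b powr p"
    using assms by (simp add: powr_mult)
  also have "\<dots> \<le> 2 powr p * (a powr p + b powr p)"
    by (intro mult_left_mono) (auto simp: max_def)
  finally show ?thesis .
qed

text \<open>Stated in \<open>ennreal\<close> without assuming a finite moment, so that it can be
  integrated over the sample space with no exceptional null set. Only the factor of the moment is
  made uniform through \<open>C\<close>; the first term keeps the true mass, because its product
  with \<open>H\<close> is what tends to 0.\<close>

lemma (in finite_measure) norm_integral_powr_le_truncated_moment:
  fixes f :: "'a \<Rightarrow> 'x::{banach,second_countable_topology}"
  assumes "f \<in> borel_measurable M" "H \<ge> 0" "p \<ge> 1" "measure M (space M) \<le> C"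
  shows "ennreal (norm (\<integral>s. f s \<partial>M) powr p) \<le>
     ennreal (2 powr p * (H * measure M (space M)) powr p) + ennreal (2 powr p * (C + 1) powr p) *
     (\<integral>\<^sup>+s. ennreal (norm (f s) powr p) * indicator {s. norm (f s) > H} s \<partial>M)"
    (is "_ \<le> _ + _ * ?D")
proof (cases ?D)
  case (real d)
  let ?c = "measure M (space M)"
  have c: "0 \<le> ?c" by simp
  note C = order_trans[OF c assms(4)]
  have "norm (\<integral>s. f s \<partial>M) \<le> H * ?c + (?c + 1) * d powr (1 / p)"
    by (rule norm_integral_le_truncated_moment) (use assms real in auto)
  also have "\<dots> \<le> H * ?c + (C + 1) * d powr (1 / p)"
    using assms by (intro add_left_mono mult_right_mono) auto
  finally have "norm (\<integral>s. f s \<partial>M) powr p \<le> (H * ?c + (C + 1) * d powr (1 / p)) powr p"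
    using assms by (intro powr_mono2) auto
  also have "\<dots> \<le> 2 powr p * ((H * ?c) powr p + ((C + 1) * d powr (1 / p)) powr p)"
    using assms C by (intro powr_add_le) auto
  also have "((C + 1) * d powr (1 / p)) powr p = (C + 1) powr p * d"
    using assms C real by (simp add: powr_mult powr_powr)
  finally show ?thesis
    using real by (simp add: ennreal_leI distrib_left mult.assoc flip: ennreal_mult ennreal_plus)
next
  case top
  \<comment> \<open>A nonzero factor makes the right-hand side infinite; a zero factor would give
    \<open>0 * \<infinity> = 0\<close>.\<close>
  have "C + 1 \<noteq> 0"
    using order_trans[OF measure_nonneg assms(4)] by simp
  then show ?thesis by (simp only: top) (simp add: ennreal_mult_top)
qed

text \<open>This is the measurability part of Tonelli's theorem: integrating out one variable of a
  jointly measurable nonnegative function leaves a measurable function of the other.\<close>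

lemma borel_measurable_truncated_moment:
  fixes Y :: "'s \<Rightarrow> 'a \<Rightarrow> 'x::{banach,second_countable_topology}"
  assumes "sigma_finite_measure N" "(\<lambda>(\<omega>, s). Y s \<omega>) \<in> borel_measurable (M \<Otimes>\<^sub>M N)"
  shows "(\<lambda>\<omega>. \<integral>\<^sup>+s. ennreal (norm (Y s \<omega>) powr p) * indicator {s. norm (Y s \<omega>) > H} s \<partial>N)
    \<in> borel_measurable M"
proof -
  interpret sigma_finite_measure N by fact
  note [measurable] = assms(2)
  have "(\<lambda>(\<omega>, s). ennreal (norm (Y s \<omega>) powr p) * (if norm (Y s \<omega>) > H then 1 else 0))
      \<in> borel_measurable (M \<Otimes>\<^sub>M N)"
    by (simp add: case_prod_beta') measurable
  then have "(\<lambda>\<omega>. \<integral>\<^sup>+s. ennreal (norm (Y s \<omega>) powr p) * (if norm (Y s \<omega>) > H then 1 else 0) \<partial>N)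
      \<in> borel_measurable M"
    by (rule borel_measurable_nn_integral)
  moreover have "ennreal (norm (Y s \<omega>) powr p) * indicator {s. norm (Y s \<omega>) > H} s
      = ennreal (norm (Y s \<omega>) powr p) * (if norm (Y s \<omega>) > H then 1 else 0)" for s \<omega>
    by simp
  ultimately show ?thesis by presburger
qed

text \<open>Markov's inequality for the \<open>p\<close>-th power of the norm bounds each tail
  probability by \<open>\<epsilon> powr - p\<close> times the moment.\<close>

lemma tendsto_in_prob_zeroI:
  fixes Y :: "nat \<Rightarrow> 'a \<Rightarrow> 'x::{banach,second_countable_topology}"
  assumes "finite_measure M" "p > 0"
    and meas: "\<forall>\<^sub>F n in sequentially. Y n \<in> borel_measurable M"
    and lim: "(\<lambda>n. \<integral>\<^sup>+\<omega>. ennreal (norm (Y n \<omega>) powr p) \<partial>M) \<longlonglongrightarrow> 0"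
  shows "tendsto_in_prob M Y (\<lambda>\<omega>. 0)"
  unfolding tendsto_in_prob_def
proof (intro conjI allI impI meas)
  interpret finite_measure M by fact
  fix \<epsilon> :: real assume "\<epsilon> > 0"
  have "(\<lambda>n. ennreal (measure M {\<omega> \<in> space M. dist (Y n \<omega>) 0 > \<epsilon>})) \<longlonglongrightarrow> 0"
  proof (rule tendsto_sandwich[where f = "\<lambda>_. 0"])
    show "(\<lambda>n. ennreal (\<epsilon> powr - p) * (\<integral>\<^sup>+\<omega>. ennreal (norm (Y n \<omega>) powr p) \<partial>M)) \<longlonglongrightarrow> 0"
      using ennreal_tendsto_cmult[OF _ lim, of "ennreal (\<epsilon> powr - p)"] by simp
    show "\<forall>\<^sub>F n in sequentially. ennreal (measure M {\<omega> \<in> space M. dist (Y n \<omega>) 0 > \<epsilon>})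
        \<le> ennreal (\<epsilon> powr - p) * (\<integral>\<^sup>+\<omega>. ennreal (norm (Y n \<omega>) powr p) \<partial>M)"
      using meas
    proof eventually_elim
      case (elim n)
      note [measurable] = elim
      have one_le: "1 \<le> ennreal (\<epsilon> powr - p) * ennreal (norm (Y n \<omega>) powr p)"
        if "dist (Y n \<omega>) 0 > \<epsilon>" for \<omega>
      proof -
        have "\<epsilon> powr - p * \<epsilon> powr p \<le> \<epsilon> powr - p * norm (Y n \<omega>) powr p"
          using that \<open>\<epsilon> > 0\<close> \<open>p > 0\<close> by (intro mult_left_mono powr_mono2) auto
        then have "1 \<le> \<epsilon> powr - p * norm (Y n \<omega>) powr p"
          using \<open>\<epsilon> > 0\<close> by (simp flip: powr_add)
        then show ?thesis by (simp flip: ennreal_mult)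
      qed
      have "emeasure M {\<omega> \<in> space M. dist (Y n \<omega>) 0 > \<epsilon>} \<le>
          emeasure M ({\<omega> \<in> space M. 1 \<le> ennreal (\<epsilon> powr - p) * ennreal (norm (Y n \<omega>) powr p)})"
        using one_le by (intro emeasure_mono) auto
      also have "\<dots> \<le> ennreal (\<epsilon> powr - p) * (\<integral>\<^sup>+\<omega>. ennreal (norm (Y n \<omega>) powr p) * indicator (space M) \<omega> \<partial>M)"
        using nn_integral_Markov_inequality[of "\<lambda>\<omega>. ennreal (norm (Y n \<omega>) powr p)" "space M" M "ennreal (\<epsilon> powr - p)"]
        by simp
      also have "\<dots> = ennreal (\<epsilon> powr - p) * (\<integral>\<^sup>+\<omega>. ennreal (norm (Y n \<omega>) powr p) \<partial>M)"
        by (intro arg_cong2[where f = "(*)"] nn_integral_cong) auto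
      finally show ?case by (simp add: emeasure_eq_measure)
    qed
  qed auto
  then show "(\<lambda>n. measure M {\<omega> \<in> space M. dist (Y n \<omega>) 0 > \<epsilon>}) \<longlonglongrightarrow> 0"
    using tendsto_ennreal_iff[of _ sequentially 0] by (simp flip: ennreal_0)
qed simp

theorem theorem3p2:
  fixes M :: "'a measure"
    and \<nu> :: "nat \<Rightarrow> 's measure"
    and X :: "nat \<Rightarrow> 's \<Rightarrow> 'a \<Rightarrow> 'x::{banach,second_countable_topology}"
    and h :: "nat \<Rightarrow> real" and p :: real
  assumes "prob_space M" and "complete_measure M"
    and "finite_measure_family \<nu>"
    and "\<And>n. n \<ge> 1 \<Longrightarrow> h n \<ge> 0"
    and "p \<ge> 1"
    and "UI_wrt M \<nu> p h X"
    and "(\<lambda>n. h n * measure (\<nu> n) (space (\<nu> n))) \<longlonglongrightarrow> 0"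
  shows "(\<exists>n0\<ge>1. \<forall>n\<ge>n0.
            (AE \<omega> in M. integrable (\<nu> n) (\<lambda>s. X n s \<omega>)) \<and>
            (\<lambda>\<omega>. \<integral>s. X n s \<omega> \<partial>\<nu> n) \<in> borel_measurable M) \<and>
         ((\<lambda>n. \<integral>\<^sup>+\<omega>. ennreal (norm (\<integral>s. X n s \<omega> \<partial>\<nu> n) powr p) \<partial>M) \<longlonglongrightarrow> 0) \<and>
         tendsto_in_prob M (\<lambda>n \<omega>. \<integral>s. X n s \<omega> \<partial>\<nu> n) (\<lambda>\<omega>. 0)"
proof -
  interpret M: prob_space M by fact
  define D where "D n \<omega> = (\<integral>\<^sup>+s. ennreal (norm (X n s \<omega>) powr p) * indicator {s. norm (X n s \<omega>) > h n} s \<partial>\<nu> n)"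
    for n \<omega>
  let ?I = "\<lambda>n \<omega>. \<integral>s. X n s \<omega> \<partial>\<nu> n"
  define C where "C = enn2real (SUP n\<in>{1..}. emeasure (\<nu> n) (space (\<nu> n)))"
  have fin: "finite_measure (\<nu> n)" if "n \<ge> 1" for n
    using assms(3) that by (auto simp: finite_measure_family_def)
  have sf: "sigma_finite_measure (\<nu> n)" if "n \<ge> 1" for n
    using fin[OF that] by (simp add: finite_measure_def)
  have le_C: "measure (\<nu> n) (space (\<nu> n)) \<le> C" if "n \<ge> 1" for n
    unfolding C_def measure_def using assms(3) that
    by (intro enn2real_mono SUP_upper) (auto simp: finite_measure_family_def)
  have X_pair: "(\<lambda>(\<omega>, s). X n s \<omega>) \<in> borel_measurable (M \<Otimes>\<^sub>M \<nu> n)" if "n \<ge> 1" for n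
    using assms(6) that by (auto simp: UI_wrt_def)
  have X_meas: "(\<lambda>s. X n s \<omega>) \<in> borel_measurable (\<nu> n)" if "n \<ge> 1" "\<omega> \<in> space M" for n \<omega>
    using measurable_Pair2[OF X_pair] that by simp
  \<comment> \<open>The Bochner integral takes the value 0 where the integrand is not integrable, so
    \<open>?I n\<close> is a total function and is measurable for every
    \<open>n \<ge> 1\<close>.\<close>
  have I_meas: "?I n \<in> borel_measurable M" if "n \<ge> 1" for n
    using sigma_finite_measure.borel_measurable_lebesgue_integral[OF sf X_pair] that by simp
  have D_meas: "D n \<in> borel_measurable M" if "n \<ge> 1" for n
    unfolding D_def using borel_measurable_truncated_moment[OF sf X_pair] that by simp
  have D_lim: "(\<lambda>n. \<integral>\<^sup>+\<omega>. D n \<omega> \<partial>M) \<longlonglongrightarrow> 0"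
    using assms(6) by (simp add: UI_wrt_def D_def)

  \<comment> \<open>The value 1 is arbitrary: a finite expectation makes \<open>D n\<close> finite
    almost surely, and a finite truncated moment implies integrability.\<close>
  have "\<forall>\<^sub>F n in sequentially. (\<integral>\<^sup>+\<omega>. D n \<omega> \<partial>M) < 1"
    using D_lim by (rule order_tendstoD) simp
  then obtain n1 where n1: "(\<integral>\<^sup>+\<omega>. D n \<omega> \<partial>M) < 1" if "n \<ge> n1" for n
    by (auto simp: eventually_sequentially)
  have "AE \<omega> in M. integrable (\<nu> n) (\<lambda>s. X n s \<omega>)" if n: "n \<ge> max 1 n1" for n
  proof -
    have "AE \<omega> in M. D n \<omega> \<noteq> \<infinity>"
      using D_meas[of n] n1[of n] n by (intro nn_integral_PInf_AE) auto
    with AE_space show ?thesis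
    proof eventually_elim
      case (elim \<omega>)
      then obtain d where "d \<ge> 0" "D n \<omega> = ennreal d" by (cases "D n \<omega>") auto
      then show ?case
        using elim n assms(4,5) X_meas fin unfolding D_def
        by (intro finite_measure.norm_integral_le_truncated_moment(1)[where H = "h n" and p = p]) auto
    qed
  qed
  then have ex: "\<exists>n0\<ge>1. \<forall>n\<ge>n0. (AE \<omega> in M. integrable (\<nu> n) (\<lambda>s. X n s \<omega>)) \<and> ?I n \<in> borel_measurable M"
    using I_meas by (intro exI[of _ "max 1 n1"]) auto

  have lim: "(\<lambda>n. \<integral>\<^sup>+\<omega>. ennreal (norm (?I n \<omega>) powr p) \<partial>M) \<longlonglongrightarrow> 0"
  proof (rule tendsto_sandwich[where f = "\<lambda>_. 0"])
    let ?m = "\<lambda>n. measure (\<nu> n) (space (\<nu> n))"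
    let ?B = "\<lambda>n. ennreal (2 powr p * (h n * ?m n) powr p)
        + ennreal (2 powr p * (C + 1) powr p) * (\<integral>\<^sup>+\<omega>. D n \<omega> \<partial>M)"
    show "\<forall>\<^sub>F n in sequentially. (\<integral>\<^sup>+\<omega>. ennreal (norm (?I n \<omega>) powr p) \<partial>M) \<le> ?B n"
      using eventually_ge_at_top[of 1]
    proof eventually_elim
      case (elim n)
      \<comment> \<open>The bound holds at every point of \<open>space M\<close>, also where
        \<open>D n\<close> is infinite, so this already works from \<open>n = 1\<close> on.\<close>
      have "(\<integral>\<^sup>+\<omega>. ennreal (norm (?I n \<omega>) powr p) \<partial>M) \<le>
        (\<integral>\<^sup>+\<omega>. ennreal (2 powr p * (h n * ?m n) powr p) + ennreal (2 powr p * (C + 1) powr p) * D n \<omega> \<partial>M)"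
        unfolding D_def using elim assms(4,5) X_meas fin le_C
        by (intro nn_integral_mono finite_measure.norm_integral_powr_le_truncated_moment) auto
      also have "\<dots> = ?B n"
        using D_meas[OF elim] by (simp add: nn_integral_add nn_integral_cmult M.emeasure_space_1)
      finally show ?case .
    qed
    \<comment> \<open>Since the base tends to 0, continuity of the power needs a positive exponent
      and an eventually nonnegative base; the sign of \<open>h n\<close> is known only for
      \<open>n \<ge> 1\<close>.\<close>
    have "(\<lambda>n. (h n * ?m n) powr p) \<longlonglongrightarrow> 0 powr p"
      using assms(4,5,7) by (intro tendsto_powr2) (auto intro!: eventually_sequentiallyI[of 1])
    then have "(\<lambda>n. 2 powr p * (h n * ?m n) powr p) \<longlonglongrightarrow> 0"
      using assms(5) by (auto intro: tendsto_mult_right_zero)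
    then have "(\<lambda>n. ennreal (2 powr p * (h n * ?m n) powr p)) \<longlonglongrightarrow> 0"
      using tendsto_ennrealI by fastforce
    moreover have "(\<lambda>n. ennreal (2 powr p * (C + 1) powr p) * (\<integral>\<^sup>+\<omega>. D n \<omega> \<partial>M)) \<longlonglongrightarrow> 0"
      using ennreal_tendsto_cmult[OF _ D_lim, of "ennreal (2 powr p * (C + 1) powr p)"] by simp
    ultimately show "?B \<longlonglongrightarrow> 0"
      using tendsto_add by fastforce
  qed auto

  have "\<forall>\<^sub>F n in sequentially. ?I n \<in> borel_measurable M"
    using I_meas by (rule eventually_sequentiallyI)
  then have "tendsto_in_prob M ?I (\<lambda>\<omega>. 0)"
    using lim assms(5) by (intro tendsto_in_prob_zeroI[where p = p]) (auto intro: M.finite_measure_axioms)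
  with ex lim show ?thesis by blast
qed

end
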